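(* Let $(\Omega,\mathcal{F},P)$ be a probability space, let $\mathfrak{Y}$ be a separable Banach space with topological dual $\mathfrak{Y}^*$, and let $1\le p\le p'\le\infty$. Let $f:\mathfrak{Y}\times\Omega\to\mathbb{R}$ be a convex integrand and suppose that $F:\mathcal{L}_{p'}(\Omega,\mathcal{F},P;\mathfrak{Y})\to\mathcal{L}_p(\Omega,\mathcal{F},P)$ is given by $[F(x)](\omega)=f(x(\omega),\omega)$, $\omega\in\Omega$. Let $x\in\mathcal{L}_{p'}(\Omega,\mathcal{F},P;\mathfrak{Y})$ and suppose that $f(\cdot,\omega)$ is convex and continuous at $x(\omega)$ for almost all $\omega\in\Omega$. Then $S\in\partial F(x)$ if and only if a function $s\in\mathcal{L}_r(\Omega,\mathcal{F},P;\mathfrak{Y}^* )$ exists, with $1/p'+1/r=1/p$, such that for almost all $\omega\in\Omega$ we have $s(\omega)\in\partial f(x(\omega),\omega)$, and for all $h\in\mathcal{L}_{p'}(\Omega,\mathcal{F},P;\mathfrak{Y})$ $$[Sh](\cdot)=\langle s(\cdot),h(\cdot)\rangle\quad\text{a.s.}$$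
   Context: Equalities and inequalities between elements of $\mathcal{L}_p(\Omega,\mathcal{F},P)$ (real-valued functions) are understood almost surely. $1/\infty=0$. Convex integrand: a function $f:\mathfrak{Y}\times\Omega\to\mathbb{R}$ that is convex and continuous in the first argument for almost all values of the second argument, and measurable in the second argument for all values of the first argument. Subdifferential of an operator: for a mapping $F:\mathfrak{X}\to\mathcal{L}_p(\Omega,\mathcal{F},P)$ on a Banach space $\mathfrak{X}$ that is convex (i.e. $F(\alpha x+(1-\alpha)y)\le\alpha F(x)+(1-\alpha)F(y)$ a.s. for all $x,y\in\mathfrak{X}$, $\alpha\in[0,1]$), $\partial F(x)$ is the set of all continuous linear operators $S:\mathfrak{X}\to\mathcal{L}_p(\Omega,\mathcal{F},P)$ such that $Sh\le F(x+h)-F(x)$ a.s. for every $h\in\mathfrak{X}$. Here $\mathfrak{X}=\mathcal{L}_{p'}(\Omega,\mathcal{F},P;\mathfrak{Y})$. $\partial f(y,\omega)=\{s\in\mathfrak{Y}^*: f(z,\omega)\ge f(y,\omega)+\langle s,z-y\rangle\ \forall z\in\mathfrak{Y}\}$ is the usual convex subdifferential of $f(\cdot,\omega)$ at $y$. $\mathcal{L}_r(\Omega,\mathcal{F},P;\mathfrak{Y}^* )$ is the usual space of (classes of) measurable functions $s:\Omega\to\mathfrak{Y}^*$ with $\|s(\cdot)\|\in\mathcal{L}_r(\Omega,\mathcal{F},P)$, and similarly for $\mathcal{L}_{p'}(\Omega,\mathcal{F},P;\mathfrak{Y})$.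
   Formalization: Measurability of s with values in the dual of Y is taken in the weak-star sense (each <s(.),y> measurable), since with norm measurability the claim fails, e.g. Y = C[0,1], f(y,w) = y(w), s(w) = Dirac measure at w; the notions agree if the dual is separable. *)

theory Defs
  imports "HOL-Probability.Probability"
begin

text \<open>
  Exponents range over the extended nonnegative reals, where 1 / \<infinity> = 0.

  Elements of Lebesgue spaces are represented by functions, equality of classes being equality
  almost everywhere. So linearity, well-definedness and continuity of operators between these
  spaces are stated up to null sets, with the Lebesgue norms acting as seminorms.
\<close>

definition Lp :: "'o measure \<Rightarrow> ennreal \<Rightarrow> ('o \<Rightarrow> 'b::real_normed_vector) set" where
  "Lp M p = {g \<in> borel_measurable M.
     if p = \<infinity> then esssup M (\<lambda>\<omega>. ennreal (norm (g \<omega>))) < \<infinity>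
     else integrable M (\<lambda>\<omega>. norm (g \<omega>) powr enn2real p)}"

definition Lp_norm :: "'o measure \<Rightarrow> ennreal \<Rightarrow> ('o \<Rightarrow> 'b::real_normed_vector) \<Rightarrow> real" where
  "Lp_norm M p g =
     (if p = \<infinity> then enn2real (esssup M (\<lambda>\<omega>. ennreal (norm (g \<omega>))))
      else (\<integral>\<omega>. norm (g \<omega>) powr enn2real p \<partial>M) powr (1 / enn2real p))"

text \<open>
  Functions with values in the dual space are measurable in the weak-star sense. The norm
  topology would be too strong when the dual is nonseparable: on the unit interval with Lebesgue measure, the Dirac
  measures \<delta>(\<omega>) in the dual of C[0,1] depend on \<omega> in a weak-star measurable way, but the map
  is neither Borel measurable nor almost separably valued for the norm, even though it represents
  a continuous linear operator. If the dual is separable the notions coincide.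
\<close>

definition Lp_dual :: "'o measure \<Rightarrow> ennreal \<Rightarrow> ('o \<Rightarrow> ('y::real_normed_vector \<Rightarrow>\<^sub>L real)) set" where
  "Lp_dual M r = {s. (\<forall>y. (\<lambda>\<omega>. blinfun_apply (s \<omega>) y) \<in> borel_measurable M)
     \<and> (\<lambda>\<omega>. norm (s \<omega>)) \<in> Lp M r}"

definition convex_integrand :: "'o measure \<Rightarrow> ('y::real_normed_vector \<Rightarrow> 'o \<Rightarrow> real) \<Rightarrow> bool" where
  "convex_integrand M f \<longleftrightarrow>
     (AE \<omega> in M. convex_on UNIV (\<lambda>y. f y \<omega>) \<and> continuous_on UNIV (\<lambda>y. f y \<omega>))
     \<and> (\<forall>y. (\<lambda>\<omega>. f y \<omega>) \<in> borel_measurable M)"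

definition subdiff :: "('y::real_normed_vector \<Rightarrow> real) \<Rightarrow> 'y \<Rightarrow> ('y \<Rightarrow>\<^sub>L real) set" where
  "subdiff g y = {s. \<forall>z. g z \<ge> g y + blinfun_apply s (z - y)}"

definition continuous_linear_op ::
  "'o measure \<Rightarrow> ennreal \<Rightarrow> ennreal \<Rightarrow> (('o \<Rightarrow> 'y::real_normed_vector) \<Rightarrow> 'o \<Rightarrow> real) \<Rightarrow> bool" where
  "continuous_linear_op M p' p S \<longleftrightarrow>
     S \<in> Lp M p' \<rightarrow> Lp M p
     \<and> (\<forall>g\<in>Lp M p'. \<forall>h\<in>Lp M p'. (AE \<omega> in M. g \<omega> = h \<omega>) \<longrightarrow> (AE \<omega> in M. S g \<omega> = S h \<omega>))
     \<and> (\<forall>g\<in>Lp M p'. \<forall>h\<in>Lp M p'. AE \<omega> in M. S (\<lambda>\<xi>. g \<xi> + h \<xi>) \<omega> = S g \<omega> + S h \<omega>)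
     \<and> (\<forall>c. \<forall>h\<in>Lp M p'. AE \<omega> in M. S (\<lambda>\<xi>. c *\<^sub>R h \<xi>) \<omega> = c * S h \<omega>)
     \<and> (\<forall>g\<in>Lp M p'. \<forall>\<epsilon>>0. \<exists>\<delta>>0. \<forall>h\<in>Lp M p'.
          Lp_norm M p' (\<lambda>\<omega>. h \<omega> - g \<omega>) < \<delta> \<longrightarrow> Lp_norm M p (\<lambda>\<omega>. S h \<omega> - S g \<omega>) < \<epsilon>)"

definition op_subdiff ::
  "'o measure \<Rightarrow> ennreal \<Rightarrow> ennreal \<Rightarrow> (('o \<Rightarrow> 'y::real_normed_vector) \<Rightarrow> 'o \<Rightarrow> real) \<Rightarrow>
   ('o \<Rightarrow> 'y) \<Rightarrow> (('o \<Rightarrow> 'y) \<Rightarrow> 'o \<Rightarrow> real) set" where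
  "op_subdiff M p' p F x = {S. continuous_linear_op M p' p S
     \<and> (\<forall>h\<in>Lp M p'. AE \<omega> in M. S h \<omega> \<le> F (\<lambda>\<xi>. x \<xi> + h \<xi>) \<omega> - F x \<omega>)}"

end

theory Submission
  imports Defs
begin

text \<open>
  That pointwise subgradients give subgradients of the operator is immediate once the operator
  \<open>h \<mapsto> \<langle>s, h\<rangle>\<close> is known to be continuous, and this is the Hoelder inequality with exponents
  \<open>r\<close> and \<open>p'\<close> (lemma \<open>Lp_Holder\<close>).

  Conversely let \<open>S\<close> be a subgradient of \<open>F\<close> at \<open>x\<close>, and write
  \<open>g(y, \<omega>) = f(x(\<omega>) + y, \<omega>) - f(x(\<omega>), \<omega>)\<close>, so that \<open>S h \<le> g(h(\<cdot>), \<cdot>)\<close> almost surely for every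
  \<open>h\<close>. The density is read off from constant functions: \<open>\<langle>s(\<omega>), y\<rangle>\<close> ought to be \<open>[S y](\<omega>)\<close>. Each
  linearity relation between constants and each inequality \<open>S y \<le> g(y, \<cdot>)\<close> costs one null set,
  so only countably many vectors can be used at once; these are taken from a dense countable
  subspace \<open>D\<close> over the rationals. For almost every \<open>\<omega>\<close> this gives a rational-linear functional on
  \<open>D\<close> below the continuous function \<open>g(\<cdot>, \<omega>)\<close>, which vanishes at 0. Such a functional is bounded
  and extends to a continuous linear functional \<open>s(\<omega>) \<le> g(\<cdot>, \<omega>)\<close> on the whole space, that is, to an
  element of \<open>\<partial>f(x(\<omega>), \<omega>)\<close> (lemma \<open>dominated_rational_linear_extends\<close>).

  That \<open>s\<close> represents \<open>S\<close> on all of the domain follows from the domination once more, with no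
  approximation of \<open>h\<close> by simple functions: applied to \<open>h - y\<close>, it gives
  \<open>S h - \<langle>s, y\<rangle> = S (h - y) \<le> g(h - y, \<cdot>)\<close>
  almost surely, simultaneously for all \<open>y \<in> D\<close>. Letting \<open>y\<close> tend to \<open>h(\<omega>)\<close> separately for each
  \<open>\<omega>\<close> yields \<open>S h \<le> \<langle>s, h\<rangle>\<close>, and the same for \<open>- h\<close> yields equality
  (lemma \<open>dominated_op_representation\<close>).

  Integrability of \<open>\<parallel>s\<parallel>\<close> is where the continuity of \<open>S\<close> enters. A measurable \<open>e\<close> with
  \<open>\<parallel>e\<parallel> \<le> 1\<close> and \<open>\<langle>s, e\<rangle> \<ge> \<parallel>s\<parallel> / 2\<close> (lemma \<open>almost_norming_selection\<close>) turns the operator bound for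
  \<open>S (\<phi> e)\<close> into a bound for the scalar multiplication \<open>\<phi> \<mapsto> \<phi> \<parallel>s\<parallel>\<close> between the Lebesgue spaces
  with exponents \<open>p'\<close> and \<open>p\<close>, and the converse of the Hoelder inequality
  (lemma \<open>converse_Holder\<close>) gives \<open>\<parallel>s\<parallel> \<in> L\<^sub>r\<close>.
\<close>

section \<open>Functionals determined on a countable dense rational subspace\<close>

text \<open>
  The finite rational combinations of a dense sequence are indexed by the countable type of lists
  of pairs (coefficient, position); sums correspond to concatenation.
\<close>

lemma countable_dense_rational_subspace:
  obtains D :: "'y::{real_normed_vector, second_countable_topology} set"
  where "countable D" "closure D = UNIV" "0 \<in> D"
    "\<And>u v. u \<in> D \<Longrightarrow> v \<in> D \<Longrightarrow> u + v \<in> D"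
    "\<And>q u. u \<in> D \<Longrightarrow> of_rat q *\<^sub>R u \<in> D"
proof -
  obtain B :: "'y set" where B: "countable B" "\<And>X. open X \<Longrightarrow> X \<noteq> {} \<Longrightarrow> \<exists>d\<in>B. d \<in> X"
    using countable_dense_setE by blast
  have "B \<noteq> {}" using B(2)[of UNIV] by auto
  define b where "b = from_nat_into B"
  have rb: "range b = B" using B(1) \<open>B \<noteq> {}\<close> by (simp add: b_def range_from_nat_into)
  define comb where "comb = (\<lambda>xs::(rat \<times> nat) list. sum_list (map (\<lambda>(q, n). of_rat q *\<^sub>R b n) xs))"
  show ?thesis
  proof (rule that[of "range comb"])
    show "countable (range comb)" by simp
    have "b n \<in> range comb" for n
      by (rule range_eqI[of _ _ "[(1, n)]"]) (simp add: comb_def)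
    then have "B \<subseteq> range comb" using rb by blast
    moreover have "closure B = UNIV"
    proof -
      have "y \<in> closure B" for y
        unfolding closure_iff_nhds_not_empty using B(2) by (metis disjoint_iff empty_iff subsetD)
      then show ?thesis by blast
    qed
    ultimately show "closure (range comb) = UNIV"
      using closure_mono by blast
    show "0 \<in> range comb" by (rule range_eqI[of _ _ "[]"]) (simp add: comb_def)
    show "u + v \<in> range comb" if "u \<in> range comb" "v \<in> range comb" for u v
    proof -
      from that obtain xs ys where "u = comb xs" "v = comb ys" by blast
      then show ?thesis by (intro range_eqI[of _ _ "xs @ ys"]) (simp add: comb_def)
    qed
    show "of_rat q *\<^sub>R u \<in> range comb" if u: "u \<in> range comb" for q u
    proof -
      from u obtain xs where "u = comb xs" by blast
      moreover have "of_rat q *\<^sub>R comb xs = comb (map (\<lambda>(r, n). (q * r, n)) xs)"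
        by (induction xs) (auto simp: comb_def scaleR_add_right of_rat_mult)
      ultimately show ?thesis by simp
    qed
  qed
qed

text \<open>
  The set where one continuous function is below another is closed.
\<close>

lemma le_on_dense_imp_le:
  fixes a b :: "'y::topological_space \<Rightarrow> real"
  assumes "closure D = UNIV" "continuous_on UNIV a" "continuous_on UNIV b"
    and "\<And>y. y \<in> D \<Longrightarrow> a y \<le> b y"
  shows "a y \<le> b y"
proof -
  have "closed {y. a y \<le> b y}"
    using assms(2,3) by (intro closed_Collect_le)
  moreover have "D \<subseteq> {y. a y \<le> b y}" using assms(4) by blast
  ultimately have "closure D \<subseteq> {y. a y \<le> b y}" by (rule closure_minimal[rotated])
  then show ?thesis using assms(1) by blast
qed

lemma eq_on_dense_imp_eq:
  fixes a b :: "'y::topological_space \<Rightarrow> real"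
  assumes "closure D = UNIV" "continuous_on UNIV a" "continuous_on UNIV b"
    and "\<And>y. y \<in> D \<Longrightarrow> a y = b y"
  shows "a y = b y"
  using le_on_dense_imp_le[of D a b y] le_on_dense_imp_le[of D b a y] assms by force

text \<open>
  A bounded rational-linear functional is Lipschitz and so extends continuously to the closure.
  Additivity and homogeneity are identities between continuous functions, hence pass from \<open>D\<close> to the
  whole space in each variable in turn; real homogeneity follows from density of the rationals in
  the scalar.
\<close>

lemma bounded_rational_linear_extends:
  fixes D :: "'y::real_normed_vector set" and l :: "'y \<Rightarrow> real"
  assumes dense: "closure D = UNIV"
    and add_mem: "\<And>u v. u \<in> D \<Longrightarrow> v \<in> D \<Longrightarrow> u + v \<in> D"
    and scale_mem: "\<And>q u. u \<in> D \<Longrightarrow> of_rat q *\<^sub>R u \<in> D"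
    and add: "\<And>u v. u \<in> D \<Longrightarrow> v \<in> D \<Longrightarrow> l (u + v) = l u + l v"
    and scale: "\<And>q u. u \<in> D \<Longrightarrow> l (of_rat q *\<^sub>R u) = of_rat q * l u"
    and bound: "\<And>u. u \<in> D \<Longrightarrow> \<bar>l u\<bar> \<le> C * norm u"
  obtains T :: "'y \<Rightarrow>\<^sub>L real" where "\<And>u. u \<in> D \<Longrightarrow> blinfun_apply T u = l u"
proof -
  have lip: "\<bar>l u - l v\<bar> \<le> C * norm (u - v)" if "u \<in> D" "v \<in> D" for u v
  proof -
    have m: "- v \<in> D" and lm: "l (- v) = - l v"
      using scale_mem[of v "-1"] scale[of v "-1"] that by simp_all
    have "l (u - v) = l u - l v" "u - v \<in> D"
      using add[OF that(1) m] add_mem[OF that(1) m] lm by simp_all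
    then show ?thesis using bound by metis
  qed
  have "\<bar>C\<bar>-lipschitz_on D l"
  proof (rule lipschitz_onI)
    fix u v assume "u \<in> D" "v \<in> D"
    from lip[OF this] show "dist (l u) (l v) \<le> \<bar>C\<bar> * dist u v"
      unfolding dist_norm real_norm_def
      by (rule order_trans) (simp add: mult_right_mono)
  qed simp
  then have "uniformly_continuous_on D l" by (rule lipschitz_on_uniformly_continuous)
  then obtain g where g: "uniformly_continuous_on (closure D) g" "\<And>u. u \<in> D \<Longrightarrow> l u = g u"
    by (rule uniformly_continuous_on_extension_on_closure) blast
  have cg: "continuous_on UNIV g"
    using g(1) dense by (simp add: uniformly_continuous_imp_continuous)
  have [continuous_intros]: "continuous_on A k \<Longrightarrow> continuous_on A (\<lambda>x. g (k x))" for A and k :: "'b::topological_space \<Rightarrow> 'y"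
    using continuous_on_compose2[OF cg] by blast
  have g_add1: "g (u + v) = g u + g v" if "u \<in> D" for u v
    by (rule eq_on_dense_imp_eq[OF dense, of "\<lambda>v. g (u + v)"])
       (use that add add_mem g(2) in \<open>auto intro!: continuous_intros\<close>)
  have g_add: "g (u + v) = g u + g v" for u v
    by (rule eq_on_dense_imp_eq[OF dense, of "\<lambda>u. g (u + v)"])
       (auto intro!: continuous_intros g_add1)
  have g_rat: "g (of_rat q *\<^sub>R u) = of_rat q * g u" for q u
    by (rule eq_on_dense_imp_eq[OF dense, of "\<lambda>u. g (of_rat q *\<^sub>R u)"])
       (use scale scale_mem g(2) in \<open>auto intro!: continuous_intros\<close>)
  have clQ: "closure (range (of_rat :: rat \<Rightarrow> real)) = UNIV"
    using Rats_closure_real by (simp add: Rats_def)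
  have g_scale: "g (c *\<^sub>R u) = c * g u" for c u
    by (rule eq_on_dense_imp_eq[OF clQ, of "\<lambda>c. g (c *\<^sub>R u)"])
       (auto intro!: continuous_intros g_rat)
  have "\<bar>g u\<bar> \<le> C * norm u" for u
    by (rule le_on_dense_imp_le[OF dense, of "\<lambda>u. \<bar>g u\<bar>"])
       (use bound g(2) in \<open>auto intro!: continuous_intros\<close>)
  then have "bounded_linear g"
    by (intro bounded_linear_intro[of g C] g_add)
       (simp_all add: g_scale mult.commute)
  then show ?thesis
    using that[of "Blinfun g"] g(2) by (simp add: bounded_linear_Blinfun_apply)
qed

text \<open>
  One-sided domination suffices for boundedness, because the functional is odd: where the
  continuous function \<open>\<phi>\<close> is below 1 on a ball around the origin, both \<open>l u\<close> and \<open>l (- u)\<close> are at most 1.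
  Scaling then bounds \<open>l\<close> by the reciprocal of the radius.
\<close>

lemma dominated_rational_linear_extends:
  fixes D :: "'y::real_normed_vector set" and l \<phi> :: "'y \<Rightarrow> real"
  assumes dense: "closure D = UNIV"
    and add_mem: "\<And>u v. u \<in> D \<Longrightarrow> v \<in> D \<Longrightarrow> u + v \<in> D"
    and scale_mem: "\<And>q u. u \<in> D \<Longrightarrow> of_rat q *\<^sub>R u \<in> D"
    and add: "\<And>u v. u \<in> D \<Longrightarrow> v \<in> D \<Longrightarrow> l (u + v) = l u + l v"
    and scale: "\<And>q u. u \<in> D \<Longrightarrow> l (of_rat q *\<^sub>R u) = of_rat q * l u"
    and cont: "continuous_on UNIV \<phi>" and "\<phi> 0 = 0"
    and le: "\<And>u. u \<in> D \<Longrightarrow> l u \<le> \<phi> u"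
  shows "\<exists>T :: 'y \<Rightarrow>\<^sub>L real. (\<forall>u\<in>D. blinfun_apply T u = l u) \<and> (\<forall>u. blinfun_apply T u \<le> \<phi> u)"
proof -
  obtain \<rho> where \<rho>: "\<rho> > 0" "\<And>u. norm u < \<rho> \<Longrightarrow> \<phi> u < 1"
  proof -
    have "isCont \<phi> 0" using cont by (simp add: continuous_on_eq_continuous_at)
    then obtain \<rho> where "\<rho> > 0" "\<And>u. norm (u - 0) < \<rho> \<Longrightarrow> norm (\<phi> u - \<phi> 0) < 1"
      unfolding isCont_def LIM_eq by (metis diff_self norm_zero zero_less_one)
    then show ?thesis using that[of \<rho>] \<open>\<phi> 0 = 0\<close> by force
  qed
  have unit: "\<bar>l u\<bar> \<le> 1" if "u \<in> D" "norm u < \<rho>" for u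
  proof -
    have "- u \<in> D" "l (- u) = - l u"
      using scale_mem[of u "-1"] scale[of u "-1"] that by simp_all
    then show ?thesis using le[of u] le[of "- u"] \<rho>(2)[of u] \<rho>(2)[of "- u"] that by force
  qed
  have bound: "\<bar>l u\<bar> \<le> (1 / \<rho>) * norm u" if "u \<in> D" for u
  proof (rule ccontr)
    assume "\<not> ?thesis"
    then have less: "norm u < \<rho> * \<bar>l u\<bar>" using \<rho>(1) by (simp add: field_simps)
    then have lpos: "0 < \<bar>l u\<bar>" using \<rho>(1) norm_ge_zero[of u] by (metis abs_eq_0 abs_ge_zero less_le mult_zero_right not_less)
    \<comment> \<open>A rational dilation that keeps \<open>u\<close> in the ball but pushes \<open>\<bar>l u\<bar>\<close> beyond 1.\<close>
    have "\<exists>q::rat. 1 / \<bar>l u\<bar> < of_rat q \<and> of_rat q * norm u < \<rho>"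
    proof (cases "norm u = 0")
      case True
      then show ?thesis using reals_Archimedean2[of "1 / \<bar>l u\<bar>"] \<rho>(1)
        by (metis mult_zero_right of_rat_of_nat_eq)
    next
      case False
      then have "1 / \<bar>l u\<bar> < \<rho> / norm u" using less lpos by (simp add: field_simps)
      then obtain q where "1 / \<bar>l u\<bar> < of_rat q" "of_rat q < \<rho> / norm u"
        using of_rat_dense by blast
      then show ?thesis using False by (intro exI[of _ q]) (simp add: field_simps)
    qed
    then obtain q where q: "1 / \<bar>l u\<bar> < of_rat q" "of_rat q * norm u < \<rho>" by blast
    have qpos: "(of_rat q :: real) > 0" using q(1) lpos by (meson less_trans zero_less_divide_1_iff)
    have "\<bar>l (of_rat q *\<^sub>R u)\<bar> \<le> 1"
      by (rule unit) (use that scale_mem q qpos in auto)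
    then show False using q(1) qpos lpos scale[OF that, of q]
      by (simp add: abs_mult field_simps)
  qed
  obtain T :: "'y \<Rightarrow>\<^sub>L real" where T: "\<And>u. u \<in> D \<Longrightarrow> blinfun_apply T u = l u"
    using bounded_rational_linear_extends[OF dense add_mem scale_mem add scale bound] by blast
  moreover have "blinfun_apply T u \<le> \<phi> u" for u
    by (rule le_on_dense_imp_le[OF dense])
       (use T le cont in \<open>auto intro!: continuous_intros\<close>)
  ultimately show ?thesis by blast
qed

lemma dual_norm_le_iff_dense:
  fixes T :: "'y::real_normed_vector \<Rightarrow>\<^sub>L real"
  assumes "closure D = UNIV" "0 \<le> c"
  shows "norm T \<le> c \<longleftrightarrow> (\<forall>u\<in>D. \<bar>blinfun_apply T u\<bar> \<le> c * norm u)"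
proof
  assume "norm T \<le> c"
  then show "\<forall>u\<in>D. \<bar>blinfun_apply T u\<bar> \<le> c * norm u"
    by (metis mult_right_mono norm_blinfun norm_ge_zero order_trans real_norm_def)
next
  assume *: "\<forall>u\<in>D. \<bar>blinfun_apply T u\<bar> \<le> c * norm u"
  have "\<bar>blinfun_apply T u\<bar> \<le> c * norm u" for u
    by (rule le_on_dense_imp_le[OF assms(1)]) (use * in \<open>auto intro!: continuous_intros\<close>)
  then show "norm T \<le> c" using assms(2) by (intro norm_blinfun_bound) auto
qed

text \<open>
  On a separable space the dual norm is determined by countably many evaluations, so weak-star
  measurability is enough to make it measurable, even if the dual is not separable.
\<close>

lemma norm_weak_star_measurable:
  fixes s :: "'o \<Rightarrow> 'y::{real_normed_vector, second_countable_topology} \<Rightarrow>\<^sub>L real"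
  assumes s[measurable]: "\<And>y. (\<lambda>\<omega>. blinfun_apply (s \<omega>) y) \<in> borel_measurable M"
  shows "(\<lambda>\<omega>. norm (s \<omega>)) \<in> borel_measurable M"
proof (rule borel_measurable_iff_le[THEN iffD2], rule allI)
  obtain D :: "'y set" where D[measurable]: "countable D" "closure D = UNIV"
    using countable_dense_rational_subspace by metis
  fix c
  show "{\<omega> \<in> space M. norm (s \<omega>) \<le> c} \<in> sets M"
  proof (cases "0 \<le> c")
    case True
    have "{\<omega> \<in> space M. \<forall>u\<in>D. \<bar>blinfun_apply (s \<omega>) u\<bar> \<le> c * norm u} \<in> sets M"
      using D(1) by measurable
    then show ?thesis by (simp add: dual_norm_le_iff_dense[OF D(2) True])
  next
    case False
    then have "{\<omega> \<in> space M. norm (s \<omega>) \<le> c} = {}" by (auto dest: order_trans[OF norm_ge_zero])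
    then show ?thesis by (simp only: sets.empty_sets)
  qed
qed

text \<open>
  The selection is the normalisation of the first member of a dense sequence whose direction almost
  attains the norm of \<open>s \<omega>\<close>; taking the first makes it measurable.
\<close>

lemma almost_norming_selection:
  fixes s :: "'o \<Rightarrow> 'y::{real_normed_vector, second_countable_topology} \<Rightarrow>\<^sub>L real"
  assumes s[measurable]: "\<And>y. (\<lambda>\<omega>. blinfun_apply (s \<omega>) y) \<in> borel_measurable M"
  obtains e where "e \<in> borel_measurable M" "\<And>\<omega>. norm (e \<omega>) \<le> 1"
    "\<And>\<omega>. norm (s \<omega>) / 2 \<le> blinfun_apply (s \<omega>) (e \<omega>)"
proof -
  note norm_weak_star_measurable[OF s, measurable]
  obtain D :: "'y set" where D: "countable D" "closure D = UNIV" "0 \<in> D"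
     "\<And>q u. u \<in> D \<Longrightarrow> of_rat q *\<^sub>R u \<in> D"
    using countable_dense_rational_subspace by metis
  define d where "d = from_nat_into D"
  have rd: "range d = D" using D by (auto simp: d_def intro!: range_from_nat_into)
  \<comment> \<open>Where \<open>s\<close> vanishes, the inequality alone would hold for every index; elsewhere it would always
    hold at the zero vector, whose normalisation is useless, so that index is then excluded.\<close>
  define P where "P n \<omega> \<longleftrightarrow> norm (s \<omega>) / 2 * norm (d n) \<le> blinfun_apply (s \<omega>) (d n)
    \<and> (d n = 0 \<longrightarrow> norm (s \<omega>) = 0)" for n \<omega>
  have [measurable]: "(\<lambda>\<omega>. P n \<omega>) \<in> measurable M (count_space UNIV)" for n
    unfolding P_def by measurable
  have ex: "\<exists>n. P n \<omega>" for \<omega>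
  proof (cases "norm (s \<omega>) = 0")
    case True
    obtain n where "d n = 0" using D(3) rd by (metis imageE)
    then show ?thesis using True by (intro exI[of _ n]) (simp add: P_def)
  next
    case False
    have "\<not> norm (s \<omega>) \<le> norm (s \<omega>) / 2" using False by auto
    then obtain u where u: "u \<in> D" "norm (s \<omega>) / 2 * norm u < \<bar>blinfun_apply (s \<omega>) u\<bar>"
      using dual_norm_le_iff_dense[OF D(2), of "norm (s \<omega>) / 2" "s \<omega>"] by force
    have "- u \<in> D" using D(4)[OF u(1), of "-1"] by simp
    then obtain v where v: "v \<in> D" "norm (s \<omega>) / 2 * norm v < blinfun_apply (s \<omega>) v"
      using u by (metis abs_if blinfun.minus_right norm_minus_cancel)
    then have "v \<noteq> 0" by (auto simp: blinfun.zero_right)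
    then show ?thesis using v rd unfolding P_def by (metis imageE less_imp_le)
  qed
  define N where "N \<omega> = (LEAST n. P n \<omega>)" for \<omega>
  have N: "P (N \<omega>) \<omega>" for \<omega> unfolding N_def by (rule LeastI_ex[OF ex])
  have [measurable]: "N \<in> measurable M (count_space UNIV)"
    unfolding N_def by measurable
  show ?thesis
  proof (rule that[of "\<lambda>\<omega>. sgn (d (N \<omega>))"])
    show "(\<lambda>\<omega>. sgn (d (N \<omega>))) \<in> borel_measurable M"
      by (rule measurable_compose[of N M "count_space UNIV" "\<lambda>n. sgn (d n)"]) auto
    show "norm (sgn (d (N \<omega>))) \<le> 1" for \<omega> by (simp add: norm_sgn)
    show "norm (s \<omega>) / 2 \<le> blinfun_apply (s \<omega>) (sgn (d (N \<omega>)))" for \<omega>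
    proof (cases "d (N \<omega>) = 0")
      case True
      then show ?thesis using N[of \<omega>] by (simp add: P_def)
    next
      case False
      then show ?thesis using N[of \<omega>]
        by (simp add: P_def sgn_div_norm blinfun.scaleR_right field_simps)
    qed
  qed
qed

section \<open>Lebesgue spaces and the two directions of the Hoelder inequality\<close>

lemma Lp_measurable: "g \<in> Lp M p \<Longrightarrow> g \<in> borel_measurable M"
  by (simp add: Lp_def)

lemma AE_le_Lp_norm_infty:
  assumes "g \<in> Lp M \<infinity>"
  shows "AE \<omega> in M. norm (g \<omega>) \<le> Lp_norm M \<infinity> g"
proof -
  have fin: "esssup M (\<lambda>\<omega>. ennreal (norm (g \<omega>))) < \<infinity>" using assms by (simp add: Lp_def)
  show ?thesis
    using esssup_AE[of "\<lambda>\<omega>. ennreal (norm (g \<omega>))" M]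
  proof eventually_elim
    case (elim \<omega>)
    have "enn2real (ennreal (norm (g \<omega>))) \<le> enn2real (esssup M (\<lambda>\<omega>. ennreal (norm (g \<omega>))))"
      using elim fin by (intro enn2real_mono) auto
    then show ?case by (simp add: Lp_norm_def)
  qed
qed

lemma Lp_infty_iff:
  "g \<in> Lp M \<infinity> \<longleftrightarrow> g \<in> borel_measurable M \<and> (\<exists>C. AE \<omega> in M. norm (g \<omega>) \<le> C)"
proof (intro iffI conjI)
  assume g: "g \<in> Lp M \<infinity>"
  then show "g \<in> borel_measurable M" by (rule Lp_measurable)
  from g show "\<exists>C. AE \<omega> in M. norm (g \<omega>) \<le> C" using AE_le_Lp_norm_infty by blast
next
  assume *: "g \<in> borel_measurable M \<and> (\<exists>C. AE \<omega> in M. norm (g \<omega>) \<le> C)"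
  then obtain C where C: "AE \<omega> in M. norm (g \<omega>) \<le> C" by blast
  have "esssup M (\<lambda>\<omega>. ennreal (norm (g \<omega>))) \<le> ennreal C"
    by (rule esssup_I) (use * C in \<open>auto elim: eventually_mono intro: ennreal_leI\<close>)
  then show "g \<in> Lp M \<infinity>"
    using * by (simp add: Lp_def le_less_trans[OF _ ennreal_less_top])
qed

lemma Lp_norm_infty_le:
  assumes "g \<in> borel_measurable M" "0 \<le> C" "AE \<omega> in M. norm (g \<omega>) \<le> C"
  shows "Lp_norm M \<infinity> g \<le> C"
proof -
  have "esssup M (\<lambda>\<omega>. ennreal (norm (g \<omega>))) \<le> ennreal C"
    by (rule esssup_I) (use assms in \<open>auto elim: eventually_mono intro: ennreal_leI\<close>)
  then show ?thesis using assms(2) by (simp add: Lp_norm_def enn2real_leI)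
qed

lemma Lp_norm_nonneg: "0 \<le> Lp_norm M p g"
  by (simp add: Lp_norm_def)

lemma Lp_finite_iff:
  "p \<noteq> \<infinity> \<Longrightarrow> g \<in> Lp M p \<longleftrightarrow>
     g \<in> borel_measurable M \<and> integrable M (\<lambda>\<omega>. norm (g \<omega>) powr enn2real p)"
  by (simp add: Lp_def)

lemma Lp_dominated:
  assumes g: "g \<in> borel_measurable M" and h: "h \<in> Lp M p"
    and le: "AE \<omega> in M. norm (g \<omega>) \<le> C * norm (h \<omega>)"
  shows "g \<in> Lp M p"
proof (cases "p = \<infinity>")
  case True
  then obtain B where B: "AE \<omega> in M. norm (h \<omega>) \<le> B" using h Lp_infty_iff by blast
  have "AE \<omega> in M. norm (g \<omega>) \<le> \<bar>C\<bar> * B"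
    using le B
  proof eventually_elim
    case (elim \<omega>)
    have "C * norm (h \<omega>) \<le> \<bar>C\<bar> * B"
      using elim by (intro mult_mono) auto
    then show ?case using elim by simp
  qed
  then show ?thesis using g True Lp_infty_iff by blast
next
  case False
  define a where "a = enn2real p"
  have a: "0 \<le> a" by (simp add: a_def)
  have "integrable M (\<lambda>\<omega>. \<bar>C\<bar> powr a * norm (h \<omega>) powr a)"
    using h False by (simp add: Lp_finite_iff a_def)
  then have "integrable M (\<lambda>\<omega>. norm (g \<omega>) powr a)"
  proof (rule Bochner_Integration.integrable_bound)
    show "(\<lambda>\<omega>. norm (g \<omega>) powr a) \<in> borel_measurable M" using g by measurable
    show "AE \<omega> in M. norm (norm (g \<omega>) powr a) \<le> norm (\<bar>C\<bar> powr a * norm (h \<omega>) powr a)"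
      using le
    proof eventually_elim
      case (elim \<omega>)
      have "C * norm (h \<omega>) \<le> \<bar>C\<bar> * norm (h \<omega>)" by (intro mult_right_mono) auto
      then have "norm (g \<omega>) powr a \<le> (\<bar>C\<bar> * norm (h \<omega>)) powr a"
        using elim a by (intro powr_mono2) auto
      then show ?case by (simp add: powr_mult)
    qed
  qed
  then show ?thesis using g False by (simp add: Lp_finite_iff a_def)
qed

lemma Lp_norm_mono:
  assumes p: "0 < p" and g: "g \<in> borel_measurable M" and h: "h \<in> Lp M p" and C: "0 \<le> C"
    and le: "AE \<omega> in M. norm (g \<omega>) \<le> C * norm (h \<omega>)"
  shows "Lp_norm M p g \<le> C * Lp_norm M p h"
proof (cases "p = \<infinity>")
  case True
  have "AE \<omega> in M. norm (g \<omega>) \<le> C * Lp_norm M \<infinity> h"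
    using le AE_le_Lp_norm_infty[OF h[unfolded True]]
    by eventually_elim (meson C mult_left_mono order_trans)
  then show ?thesis unfolding True
    using C by (intro Lp_norm_infty_le[OF g]) (simp_all add: Lp_norm_nonneg)
next
  case False
  define a where "a = enn2real p"
  have a: "0 < a" using p False by (simp add: a_def enn2real_positive_iff less_top)
  have gL: "g \<in> Lp M p" by (rule Lp_dominated[OF g h le])
  have "(\<integral>\<omega>. norm (g \<omega>) powr a \<partial>M) \<le> (\<integral>\<omega>. C powr a * norm (h \<omega>) powr a \<partial>M)"
  proof (rule integral_mono_AE)
    show "AE \<omega> in M. norm (g \<omega>) powr a \<le> C powr a * norm (h \<omega>) powr a"
      using le
    proof eventually_elim
      case (elim \<omega>)
      then have "norm (g \<omega>) powr a \<le> (C * norm (h \<omega>)) powr a"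
        using a by (intro powr_mono2) auto
      then show ?case using C by (simp add: powr_mult)
    qed
  qed (use gL h False in \<open>simp_all add: Lp_finite_iff a_def\<close>)
  then have "(\<integral>\<omega>. norm (g \<omega>) powr a \<partial>M) powr (1/a)
      \<le> (C powr a * (\<integral>\<omega>. norm (h \<omega>) powr a \<partial>M)) powr (1/a)"
    using a by (intro powr_mono2) (auto intro!: integral_nonneg)
  also have "\<dots> = C * (\<integral>\<omega>. norm (h \<omega>) powr a \<partial>M) powr (1/a)"
    using a C by (subst powr_mult) (auto simp: powr_powr)
  finally show ?thesis using False by (simp add: Lp_norm_def a_def)
qed

lemma Lp_scaleR:
  assumes "h \<in> Lp M p"
  shows "(\<lambda>\<omega>. c *\<^sub>R h \<omega>) \<in> Lp M p"
  by (rule Lp_dominated[OF _ assms, of _ "\<bar>c\<bar>"])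
     (use Lp_measurable[OF assms] in \<open>auto intro: borel_measurable_scaleR\<close>)

lemma Lp_add:
  fixes g h :: "'o \<Rightarrow> 'b::{real_normed_vector, second_countable_topology}"
  assumes g: "g \<in> Lp M p" and h: "h \<in> Lp M p"
  shows "(\<lambda>\<omega>. g \<omega> + h \<omega>) \<in> Lp M p"
proof -
  have [measurable]: "g \<in> borel_measurable M" "h \<in> borel_measurable M"
    using g h by (simp_all add: Lp_measurable)
  show ?thesis
  proof (cases "p = \<infinity>")
    case True
    obtain B C where "AE \<omega> in M. norm (g \<omega>) \<le> B" "AE \<omega> in M. norm (h \<omega>) \<le> C"
      using g h Lp_infty_iff unfolding True by metis
    then have "AE \<omega> in M. norm (g \<omega> + h \<omega>) \<le> B + C"
      by eventually_elim (meson add_mono norm_triangle_ineq order_trans)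
    then show ?thesis unfolding True Lp_infty_iff by auto
  next
    case False
    define a where "a = enn2real p"
    have a: "0 \<le> a" by (simp add: a_def)
    have "integrable M (\<lambda>\<omega>. 2 powr a * (norm (g \<omega>) powr a + norm (h \<omega>) powr a))"
      using g h False by (simp add: Lp_finite_iff a_def)
    then have "integrable M (\<lambda>\<omega>. norm (g \<omega> + h \<omega>) powr a)"
    proof (rule Bochner_Integration.integrable_bound)
      have "norm (u + v) powr a \<le> 2 powr a * (norm u powr a + norm v powr a)" for u v :: 'b
      proof -
        have "norm (u + v) powr a \<le> (2 * max (norm u) (norm v)) powr a"
          using norm_triangle_ineq[of u v] a by (intro powr_mono2) auto
        also have "\<dots> \<le> 2 powr a * (norm u powr a + norm v powr a)"
          by (auto simp: powr_mult max_def)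
        finally show ?thesis .
      qed
      then show "AE \<omega> in M. norm (norm (g \<omega> + h \<omega>) powr a)
          \<le> norm (2 powr a * (norm (g \<omega>) powr a + norm (h \<omega>) powr a))"
        by (intro always_eventually) auto
    qed measurable
    then show ?thesis using False by (simp add: Lp_finite_iff a_def)
  qed
qed

lemma (in finite_measure) Lp_bounded:
  assumes "g \<in> borel_measurable M" "AE \<omega> in M. norm (g \<omega>) \<le> C"
  shows "g \<in> Lp M p"
proof (rule Lp_dominated[OF assms(1)])
  show "(\<lambda>_. 1 :: real) \<in> Lp M p"
    by (cases "p = \<infinity>") (auto simp: Lp_infty_iff Lp_finite_iff simp del: infinity_ennreal_def)
  show "AE \<omega> in M. norm (g \<omega>) \<le> C * norm (1 :: real)" using assms(2) by simp
qed

text \<open>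
  The degenerate solutions of the exponent relation have to be treated apart: the real-valued
  formulas for the norms are available only if all three exponents are finite.
\<close>

lemma conjugate_exponent_cases:
  fixes p p' r :: ennreal
  assumes "1 \<le> p" "p \<le> p'" "1 / p' + 1 / r = 1 / p"
  obtains (infinite) "p' = \<infinity>" "r = p"
    | (equal) a where "1 \<le> a" "p = ennreal a" "p' = ennreal a" "r = \<infinity>"
    | (proper) a b c where "1 \<le> a" "1 \<le> b" "0 < c" "1 / b + 1 / c = 1 / a"
        "p = ennreal a" "p' = ennreal b" "r = ennreal c"
proof (cases p')
  case top
  then have "inverse r = inverse p" using assms(3) by (simp add: divide_ennreal_def)
  moreover have "inverse (inverse x) = x" for x :: ennreal
    by (cases x rule: ennreal_cases; cases "x = 0") (auto simp: inverse_ennreal)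
  ultimately have "r = p" by metis
  then show ?thesis using top by (intro infinite) auto
next
  case (real b)
  then obtain a where a: "p = ennreal a" "0 \<le> a" using assms(2) by (cases p) (auto simp: top_unique)
  have a1: "1 \<le> a" using assms(1) a by (metis ennreal_1 ennreal_le_iff)
  have ab: "a \<le> b" using assms(2) a real by (simp add: ennreal_le_iff)
  have pp: "1 / p = ennreal (1 / a)" "1 / p' = ennreal (1 / b)"
    using a a1 ab real by (simp_all add: divide_ennreal flip: ennreal_1)
  show ?thesis
  proof (cases r)
    case top
    then have "ennreal (1 / b) = ennreal (1 / a)" using assms(3) pp by simp
    then have "a = b" using a1 ab by (simp add: ennreal_inj)
    then show ?thesis using a a1 real top by (intro equal[of a]) auto
  next
    case (real c)
    have "c \<noteq> 0"
    proof
      assume "c = 0"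
      then have "1 / r = \<infinity>" using real by (simp add: divide_ennreal_def)
      then show False using assms(3) pp by simp
    qed
    then have c: "0 < c" using real by simp
    have "ennreal (1 / b + 1 / c) = ennreal (1 / a)"
    proof -
      have "1 / r = ennreal (1 / c)" using c real by (simp add: divide_ennreal flip: ennreal_1)
      then show ?thesis using assms(3) pp a1 ab c by (simp add: ennreal_plus)
    qed
    then have "1 / b + 1 / c = 1 / a" using a1 ab c by (subst (asm) ennreal_inj) auto
    then show ?thesis using a a1 ab c real \<open>p' = ennreal b\<close> by (intro proper[of a b c]) auto
  qed
qed

text \<open>
  The Hoelder inequality with a free exponent on the left: since \<open>a / c + a / b = 1\<close>, the Young inequality
  bounds \<open>(u v)\<^sup>a\<close>, after normalising both integrals to 1, by a convex combination of \<open>u\<^sup>c\<close> and \<open>v\<^sup>b\<close>.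
\<close>

lemma integral_powr_Holder:
  fixes u v w :: "'o \<Rightarrow> real"
  assumes abc: "0 < a" "0 < b" "0 < c" "1 / b + 1 / c = 1 / a"
    and u: "integrable M (\<lambda>\<omega>. u \<omega> powr c)" "\<And>\<omega>. 0 \<le> u \<omega>"
    and v: "integrable M (\<lambda>\<omega>. v \<omega> powr b)" "\<And>\<omega>. 0 \<le> v \<omega>"
    and w: "w \<in> borel_measurable M" "\<And>\<omega>. 0 \<le> w \<omega>" "AE \<omega> in M. w \<omega> \<le> u \<omega> * v \<omega>"
  shows "(\<integral>\<omega>. w \<omega> powr a \<partial>M) powr (1 / a)
    \<le> (\<integral>\<omega>. u \<omega> powr c \<partial>M) powr (1 / c) * (\<integral>\<omega>. v \<omega> powr b \<partial>M) powr (1 / b)"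
proof -
  define I J where "I = (\<integral>\<omega>. u \<omega> powr c \<partial>M)" and "J = (\<integral>\<omega>. v \<omega> powr b \<partial>M)"
  have IJ: "0 \<le> I" "0 \<le> J" by (simp_all add: I_def J_def)
  have \<alpha>\<beta>: "a / c + a / b = 1"
  proof -
    have "a / c + a / b = a * (1 / b + 1 / c)" by (simp add: field_simps)
    then show ?thesis using abc by simp
  qed
  show ?thesis
  proof (cases "I = 0 \<or> J = 0")
    case True
    then have "(AE \<omega> in M. u \<omega> powr c = 0) \<or> (AE \<omega> in M. v \<omega> powr b = 0)"
      using u(1) v(1) unfolding I_def J_def by (subst (asm) (1 2) integral_nonneg_eq_0_iff_AE) auto
    then have "AE \<omega> in M. u \<omega> * v \<omega> = 0" by (auto elim: eventually_mono)
    then have "AE \<omega> in M. w \<omega> powr a = 0"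
      using w(3) by eventually_elim (use w(2) in \<open>metis order_antisym powr_0\<close>)
    then have "(\<integral>\<omega>. w \<omega> powr a \<partial>M) = 0" by (rule integral_eq_zero_AE)
    then show ?thesis by simp
  next
    case False
    then have pos: "0 < I" "0 < J" using IJ by auto
    define R where "R \<omega> = (a / c) * (u \<omega> powr c / I) + (a / b) * (v \<omega> powr b / J)" for \<omega>
    have young: "w \<omega> powr a \<le> I powr (a / c) * J powr (a / b) * R \<omega>"
      if "w \<omega> \<le> u \<omega> * v \<omega>" for \<omega>
    proof -
      have "w \<omega> powr a \<le> (u \<omega> * v \<omega>) powr a"
        using that w(2) abc by (intro powr_mono2) auto
      also have "\<dots> = (u \<omega> powr c) powr (a / c) * (v \<omega> powr b) powr (a / b)"
        using abc u(2) v(2) by (simp add: powr_powr powr_mult)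
      also have "\<dots> = I powr (a / c) * J powr (a / b) *
          ((u \<omega> powr c / I) powr (a / c) * (v \<omega> powr b / J) powr (a / b))"
        using pos by (simp add: powr_divide)
      also have "\<dots> \<le> I powr (a / c) * J powr (a / b) * R \<omega>"
      proof (rule mult_left_mono)
        show "(u \<omega> powr c / I) powr (a / c) * (v \<omega> powr b / J) powr (a / b) \<le> R \<omega>"
        \<comment> \<open>The Young inequality for weighted powers asks for positive arguments.\<close>
        proof (cases "u \<omega> = 0 \<or> v \<omega> = 0")
          case True
          then show ?thesis using abc pos by (auto simp: R_def)
        next
          case False
          then show ?thesis unfolding R_def using abc pos \<alpha>\<beta>
            by (intro Youngs_inequality_0) auto
        qed
      qed simp
      finally show ?thesis .
    qed
    have iR: "integrable M R" unfolding R_def using u(1) v(1) by auto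
    have "(\<integral>\<omega>. R \<omega> \<partial>M) = (a / c) * (I / I) + (a / b) * (J / J)"
      unfolding R_def I_def J_def using u(1) v(1) by simp
    then have intR: "(\<integral>\<omega>. R \<omega> \<partial>M) = 1" using pos \<alpha>\<beta> by simp
    have iR': "integrable M (\<lambda>\<omega>. I powr (a / c) * J powr (a / b) * R \<omega>)" using iR by simp
    have "(\<integral>\<omega>. w \<omega> powr a \<partial>M) \<le> (\<integral>\<omega>. I powr (a / c) * J powr (a / b) * R \<omega> \<partial>M)"
    proof (rule integral_mono_AE[OF _ iR'])
      show le: "AE \<omega> in M. w \<omega> powr a \<le> I powr (a / c) * J powr (a / b) * R \<omega>"
        using w(3) by eventually_elim (rule young)
      show "integrable M (\<lambda>\<omega>. w \<omega> powr a)"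
        by (rule Bochner_Integration.integrable_bound[OF iR'])
           (use w(1) le in \<open>auto elim!: eventually_mono\<close>)
    qed
    also have "\<dots> = I powr (a / c) * J powr (a / b)" using intR by simp
    finally have "(\<integral>\<omega>. w \<omega> powr a \<partial>M) powr (1 / a) \<le> (I powr (a / c) * J powr (a / b)) powr (1 / a)"
      using abc by (intro powr_mono2) auto
    also have "\<dots> = I powr (1 / c) * J powr (1 / b)"
      using abc by (simp add: powr_mult powr_powr)
    finally show ?thesis unfolding I_def J_def .
  qed
qed

lemma Lp_Holder:
  assumes exps: "1 \<le> p" "p \<le> p'" "1 / p' + 1 / r = 1 / p"
    and u: "u \<in> Lp M r" and v: "v \<in> Lp M p'" and w: "w \<in> borel_measurable M"
    and le: "AE \<omega> in M. norm (w \<omega>) \<le> norm (u \<omega>) * norm (v \<omega>)"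
  shows "Lp_norm M p w \<le> Lp_norm M r u * Lp_norm M p' v"
  using exps
proof (cases rule: conjugate_exponent_cases)
  case infinite
  have "AE \<omega> in M. norm (w \<omega>) \<le> Lp_norm M p' v * norm (u \<omega>)"
    using le AE_le_Lp_norm_infty[OF v[unfolded infinite]]
  proof eventually_elim
    case (elim \<omega>)
    then have "norm (u \<omega>) * norm (v \<omega>) \<le> norm (u \<omega>) * Lp_norm M p' v"
      using infinite by (intro mult_left_mono) auto
    then show ?case using elim by (simp add: mult.commute)
  qed
  then have "Lp_norm M p w \<le> Lp_norm M p' v * Lp_norm M p u"
    using u w infinite exps(1) by (intro Lp_norm_mono) (auto simp: Lp_norm_nonneg order.strict_trans2[OF zero_less_one])
  then show ?thesis using infinite by (simp add: mult.commute)
next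
  case (equal a)
  have "AE \<omega> in M. norm (w \<omega>) \<le> Lp_norm M r u * norm (v \<omega>)"
    using le AE_le_Lp_norm_infty[OF u[unfolded equal]]
  proof eventually_elim
    case (elim \<omega>)
    then have "norm (u \<omega>) * norm (v \<omega>) \<le> Lp_norm M r u * norm (v \<omega>)"
      using equal by (intro mult_right_mono) auto
    then show ?case using elim by simp
  qed
  then have "Lp_norm M p w \<le> Lp_norm M r u * Lp_norm M p v"
    using v w equal exps(1) by (intro Lp_norm_mono) (auto simp: Lp_norm_nonneg order.strict_trans2[OF zero_less_one])
  then show ?thesis using equal by simp
next
  case (proper a b c)
  then show ?thesis
    using u v w le integral_powr_Holder[of a b c M "\<lambda>\<omega>. norm (u \<omega>)" "\<lambda>\<omega>. norm (v \<omega>)" "\<lambda>\<omega>. norm (w \<omega>)"]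
    by (simp add: Lp_norm_def Lp_finite_iff)
qed

text \<open>
  The extremal test function is \<open>w\<close> to the power \<open>r / p'\<close>, for which both sides are powers of the
  integral of \<open>w\<^sup>r\<close>; truncating at height \<open>n\<close> makes it bounded and that integral finite, and the
  resulting estimate does not depend on \<open>n\<close>. If \<open>p'\<close> is infinite this is the constant 1; if \<open>r\<close> is
  infinite and \<open>p'\<close> finite, it is replaced by the indicator of the set where \<open>w\<close> exceeds the operator
  bound.
\<close>

lemma (in finite_measure) converse_Holder:
  fixes w :: "'a \<Rightarrow> real"
  assumes exps: "1 \<le> p" "p \<le> p'" "1 / p' + 1 / r = 1 / p"
    and w[measurable]: "w \<in> borel_measurable M" and nonneg: "\<And>\<omega>. 0 \<le> w \<omega>"
    and test: "\<And>\<phi> C. \<phi> \<in> borel_measurable M \<Longrightarrow> (\<And>\<omega>. 0 \<le> \<phi> \<omega> \<and> \<phi> \<omega> \<le> C) \<Longrightarrow>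
      (\<lambda>\<omega>. \<phi> \<omega> * w \<omega>) \<in> Lp M p \<and> Lp_norm M p (\<lambda>\<omega>. \<phi> \<omega> * w \<omega>) \<le> K * Lp_norm M p' \<phi>"
  shows "w \<in> Lp M r"
  using exps
proof (cases rule: conjugate_exponent_cases)
  case infinite
  then show ?thesis using test[of "\<lambda>_. 1" 1] by simp
next
  case (equal a)
  define K' where "K' = max K 0"
  define A where "A = {\<omega> \<in> space M. K' < w \<omega>}"
  have A[measurable]: "A \<in> sets M" unfolding A_def by measurable
  have K': "0 \<le> K'" "K \<le> K'" by (auto simp: K'_def)
  define J where "J = (\<integral>\<omega>. indicator A \<omega> \<partial>M :: real)"
  have J: "0 \<le> J" by (simp add: J_def)
  have e1: "\<bar>indicator A \<omega> * w \<omega>\<bar> powr a = indicator A \<omega> * w \<omega> powr a"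
     "(indicator A \<omega> :: real) powr a = indicator A \<omega>" for \<omega>
    using nonneg equal by (auto simp: indicator_def)
  have T: "(\<lambda>\<omega>. indicator A \<omega> * w \<omega>) \<in> Lp M p"
     "Lp_norm M p (\<lambda>\<omega>. indicator A \<omega> * w \<omega>) \<le> K * Lp_norm M p' (indicator A :: 'a \<Rightarrow> real)"
    using test[of "indicator A" 1] by (auto simp: indicator_def)
  have i1: "integrable M (\<lambda>\<omega>. indicator A \<omega> * w \<omega> powr a)"
    using T(1) equal by (simp add: Lp_finite_iff e1)
  have "(\<integral>\<omega>. indicator A \<omega> * w \<omega> powr a \<partial>M) powr (1 / a) \<le> K * J powr (1 / a)"
    using T(2) equal by (simp add: Lp_norm_def e1 J_def)
  also have "\<dots> \<le> K' * J powr (1 / a)" using K' by (intro mult_right_mono) auto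
  finally have "((\<integral>\<omega>. indicator A \<omega> * w \<omega> powr a \<partial>M) powr (1 / a)) powr a \<le> (K' * J powr (1 / a)) powr a"
    using equal by (intro powr_mono2) auto
  then have le: "(\<integral>\<omega>. indicator A \<omega> * w \<omega> powr a \<partial>M) \<le> K' powr a * J"
    using equal K' J by (simp add: powr_powr powr_mult integral_nonneg)
  \<comment> \<open>The estimate says that this nonnegative function, positive exactly on \<open>A\<close>, has integral at most 0.\<close>
  define G where "G \<omega> = indicator A \<omega> * (w \<omega> powr a - K' powr a)" for \<omega>
  have G_nonneg: "0 \<le> G \<omega>" for \<omega>
    using equal K' by (auto simp: G_def A_def indicator_def intro: powr_mono2)
  have iA: "integrable M (indicator A :: 'a \<Rightarrow> real)"
    by (simp add: integrable_indicator_iff emeasure_finite flip: less_top)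
  have iG: "integrable M G"
    unfolding G_def right_diff_distrib using i1 iA by (intro Bochner_Integration.integrable_diff) auto
  have "(\<integral>\<omega>. G \<omega> \<partial>M) = (\<integral>\<omega>. indicator A \<omega> * w \<omega> powr a \<partial>M) - J * K' powr a"
    unfolding G_def right_diff_distrib J_def using i1 iA by (subst Bochner_Integration.integral_diff) auto
  moreover have "0 \<le> (\<integral>\<omega>. G \<omega> \<partial>M)" using G_nonneg by (intro integral_nonneg_AE) auto
  ultimately have "(\<integral>\<omega>. G \<omega> \<partial>M) = 0" using le by (simp add: mult.commute)
  then have "AE \<omega> in M. G \<omega> = 0"
    using iG G_nonneg by (subst (asm) integral_nonneg_eq_0_iff_AE) auto
  then have "AE \<omega> in M. w \<omega> \<le> K'"
  proof (rule AE_mp, intro AE_I2 impI)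
    fix \<omega> assume "\<omega> \<in> space M" "G \<omega> = 0"
    show "w \<omega> \<le> K'"
    proof (rule ccontr)
      assume "\<not> w \<omega> \<le> K'"
      then have "\<omega> \<in> A" "K' powr a < w \<omega> powr a"
        using \<open>\<omega> \<in> space M\<close> equal K' by (auto simp: A_def intro!: powr_less_mono2)
      then show False using \<open>G \<omega> = 0\<close> by (simp add: G_def)
    qed
  qed
  then show ?thesis using equal nonneg by (auto simp: Lp_infty_iff simp del: infinity_ennreal_def)
next
  case (proper a b c)
  have ca: "(c / b + 1) * a = c"
  proof -
    have "c / b + 1 = c * (1 / b + 1 / c)" using proper(3) by (simp add: distrib_left)
    then show ?thesis using proper by simp
  qed
  define A where "A n = {\<omega> \<in> space M. w \<omega> \<le> real n}" for n :: nat
  have A[measurable]: "A n \<in> sets M" for n unfolding A_def by measurable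
  define \<phi> where "\<phi> n \<omega> = indicator (A n) \<omega> * w \<omega> powr (c / b)" for n \<omega>
  have [measurable]: "\<phi> n \<in> borel_measurable M" for n unfolding \<phi>_def by measurable
  have \<phi>_bd: "0 \<le> \<phi> n \<omega> \<and> \<phi> n \<omega> \<le> real n powr (c / b)" for n \<omega>
    using proper nonneg by (auto simp: \<phi>_def A_def indicator_def intro!: powr_mono2)
  have test_\<phi>: "(\<lambda>\<omega>. \<phi> n \<omega> * w \<omega>) \<in> Lp M p"
      "Lp_norm M p (\<lambda>\<omega>. \<phi> n \<omega> * w \<omega>) \<le> K * Lp_norm M p' (\<phi> n)" for n
    using test[of "\<phi> n" "real n powr (c / b)"] \<phi>_bd by auto
  define I where "I n = (\<integral>\<omega>. indicator (A n) \<omega> * w \<omega> powr c \<partial>M)" for n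
  have I: "0 \<le> I n" for n unfolding I_def by (intro integral_nonneg_AE) auto
  have e1: "\<bar>\<phi> n \<omega>\<bar> powr b = indicator (A n) \<omega> * w \<omega> powr c" for n \<omega>
    using proper by (auto simp: \<phi>_def indicator_def powr_powr)
  have e2: "\<bar>\<phi> n \<omega> * w \<omega>\<bar> powr a = indicator (A n) \<omega> * w \<omega> powr c" for n \<omega>
  proof (cases "w \<omega> = 0")
    case True
    then show ?thesis using proper by (simp add: \<phi>_def)
  next
    case False
    then have "w \<omega> powr (c / b) * w \<omega> = w \<omega> powr (c / b + 1)"
      using nonneg[of \<omega>] by (simp add: powr_add)
    then show ?thesis using nonneg[of \<omega>] ca by (auto simp: \<phi>_def indicator_def powr_powr)
  qed
  have IK: "I n \<le> \<bar>K\<bar> powr c" for n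
  proof (cases "I n = 0")
    case False
    then have pos: "0 < I n" using I[of n] by simp
    \<comment> \<open>Both norms are powers of \<open>I n\<close>, and the exponents differ by \<open>1 / c\<close>.\<close>
    have "I n powr (1 / a) \<le> K * I n powr (1 / b)"
      using test_\<phi>(2)[of n] proper by (simp add: Lp_norm_def e1 e2 I_def)
    moreover have "I n powr (1 / a) = I n powr (1 / c) * I n powr (1 / b)"
      using pos proper(4) by (metis add.commute powr_add)
    ultimately have "I n powr (1 / c) \<le> K" using pos by simp
    then have "(I n powr (1 / c)) powr c \<le> \<bar>K\<bar> powr c"
      using proper by (intro powr_mono2) auto
    then show ?thesis using pos proper by (simp add: powr_powr)
  qed simp
  have "integrable M (\<lambda>\<omega>. w \<omega> powr c)"
  proof (rule integrableI_bounded)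
    have int: "integrable M (\<lambda>\<omega>. indicator (A n) \<omega> * w \<omega> powr c)" for n
      using test_\<phi>(1)[of n] proper by (simp add: Lp_finite_iff e2)
    have "(\<integral>\<^sup>+\<omega>. ennreal (norm (w \<omega> powr c)) \<partial>M)
        = (\<integral>\<^sup>+\<omega>. (SUP n. ennreal (indicator (A n) \<omega> * w \<omega> powr c)) \<partial>M)"
    proof (rule nn_integral_cong)
      fix \<omega> assume \<omega>: "\<omega> \<in> space M"
      obtain n where "w \<omega> \<le> real n" using real_arch_simple by blast
      then have "indicator (A n) \<omega> * w \<omega> powr c = w \<omega> powr c" using \<omega> by (simp add: A_def)
      then have "ennreal (w \<omega> powr c) \<le> (SUP n. ennreal (indicator (A n) \<omega> * w \<omega> powr c))"
        by (intro SUP_upper2[of n]) auto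
      moreover have "(SUP n. ennreal (indicator (A n) \<omega> * w \<omega> powr c)) \<le> ennreal (w \<omega> powr c)"
        by (intro SUP_least ennreal_leI) (auto simp: indicator_def)
      ultimately show "ennreal (norm (w \<omega> powr c)) = (SUP n. ennreal (indicator (A n) \<omega> * w \<omega> powr c))"
        by simp
    qed
    also have "\<dots> = (SUP n. \<integral>\<^sup>+\<omega>. ennreal (indicator (A n) \<omega> * w \<omega> powr c) \<partial>M)"
      by (rule nn_integral_monotone_convergence_SUP)
         (auto simp: incseq_def le_fun_def A_def indicator_def intro!: ennreal_leI)
    also have "\<dots> = (SUP n. ennreal (I n))"
      unfolding I_def using int by (subst nn_integral_eq_integral) auto
    also have "\<dots> \<le> ennreal (\<bar>K\<bar> powr c)"
      by (intro SUP_least ennreal_leI IK)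
    finally show "(\<integral>\<^sup>+\<omega>. ennreal (norm (w \<omega> powr c)) \<partial>M) < \<infinity>"
      by (simp add: le_less_trans[OF _ ennreal_less_top])
  qed measurable
  then show ?thesis using proper nonneg by (simp add: Lp_finite_iff)
qed

section \<open>Operators given by a weak-star measurable density\<close>

lemma continuous_linear_op_scale:
  assumes "continuous_linear_op M p' p S" "h \<in> Lp M p'"
  shows "AE \<omega> in M. S (\<lambda>\<xi>. c *\<^sub>R h \<xi>) \<omega> = c * S h \<omega>"
  using assms by (simp add: continuous_linear_op_def)

lemma continuous_linear_op_add:
  assumes "continuous_linear_op M p' p S" "g \<in> Lp M p'" "h \<in> Lp M p'"
  shows "AE \<omega> in M. S (\<lambda>\<xi>. g \<xi> + h \<xi>) \<omega> = S g \<omega> + S h \<omega>"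
  using assms by (simp add: continuous_linear_op_def)

lemma continuous_linear_op_mem:
  assumes "continuous_linear_op M p' p S" "h \<in> Lp M p'"
  shows "S h \<in> Lp M p"
  using assms by (auto simp: continuous_linear_op_def)

text \<open>
  Continuity at the origin gives a bound on a small ball, and homogeneity carries it everywhere. As
  the norms are only seminorms, functions of norm 0 need the bound at every scale.
\<close>

lemma (in finite_measure) continuous_linear_op_bounded:
  assumes S: "continuous_linear_op M p' p S" and p: "0 < p" "0 < p'"
  obtains K where "0 \<le> K" "\<And>h. h \<in> Lp M p' \<Longrightarrow> Lp_norm M p (S h) \<le> K * Lp_norm M p' h"
proof -
  have zero: "(\<lambda>_. 0) \<in> Lp M p'" by (rule Lp_bounded[of _ 0]) auto
  have S0: "AE \<omega> in M. S (\<lambda>_. 0) \<omega> = 0"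
    using continuous_linear_op_scale[OF S zero, of 0] by simp
  obtain \<delta> where \<delta>: "0 < \<delta>" "\<And>h. h \<in> Lp M p' \<Longrightarrow> Lp_norm M p' h < \<delta> \<Longrightarrow>
      Lp_norm M p (\<lambda>\<omega>. S h \<omega> - S (\<lambda>_. 0) \<omega>) < 1"
  proof -
    have "\<forall>g\<in>Lp M p'. \<forall>\<epsilon>>0. \<exists>\<delta>>0. \<forall>h\<in>Lp M p'. Lp_norm M p' (\<lambda>\<omega>. h \<omega> - g \<omega>) < \<delta> \<longrightarrow>
        Lp_norm M p (\<lambda>\<omega>. S h \<omega> - S g \<omega>) < \<epsilon>"
      using S unfolding continuous_linear_op_def by (elim conjE)
    from this[rule_format, OF zero zero_less_one] show ?thesis using that by auto
  qed
  have scaled: "Lp_norm M p (S h) \<le> 1 / t"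
    if h: "h \<in> Lp M p'" and t: "0 < t" "t * Lp_norm M p' h < \<delta>" for h t
  proof -
    let ?h = "\<lambda>\<omega>. t *\<^sub>R h \<omega>"
    have th: "?h \<in> Lp M p'" by (rule Lp_scaleR[OF h])
    have [measurable]: "S h \<in> borel_measurable M" "S ?h \<in> borel_measurable M"
        "S (\<lambda>_. 0) \<in> borel_measurable M"
      using continuous_linear_op_mem[OF S] h th zero by (auto intro: Lp_measurable)
    have "Lp_norm M p' ?h \<le> t * Lp_norm M p' h"
      using t h Lp_measurable[OF th] by (intro Lp_norm_mono p) auto
    then have small: "Lp_norm M p (\<lambda>\<omega>. S ?h \<omega> - S (\<lambda>_. 0) \<omega>) < 1"
      using \<delta>(2)[OF th] t by simp
    have eq: "AE \<omega> in M. S ?h \<omega> - S (\<lambda>_. 0) \<omega> = t * S h \<omega>"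
      using S0 continuous_linear_op_scale[OF S h, of t] by eventually_elim simp
    have "(\<lambda>\<omega>. S ?h \<omega> - S (\<lambda>_. 0) \<omega>) \<in> Lp M p"
      by (rule Lp_dominated[OF _ continuous_linear_op_mem[OF S h], of _ t])
         (use eq t in \<open>auto elim!: eventually_mono simp: abs_mult\<close>)
    then have "Lp_norm M p (S h) \<le> (1 / t) * Lp_norm M p (\<lambda>\<omega>. S ?h \<omega> - S (\<lambda>_. 0) \<omega>)"
      using eq t by (intro Lp_norm_mono p) (auto elim!: eventually_mono simp: abs_mult)
    also have "\<dots> \<le> (1 / t) * 1" using small t by (intro mult_left_mono) auto
    finally show ?thesis by simp
  qed
  have "Lp_norm M p (S h) \<le> (2 / \<delta>) * Lp_norm M p' h" if h: "h \<in> Lp M p'" for h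
  proof (cases "Lp_norm M p' h = 0")
    case True
    have "Lp_norm M p (S h) \<le> 0"
    proof (rule field_le_epsilon)
      fix e :: real assume "0 < e"
      then show "Lp_norm M p (S h) \<le> 0 + e"
        using scaled[OF h, of "1 / e"] True \<delta>(1) by simp
    qed
    then show ?thesis using True by simp
  next
    case False
    then have "0 < Lp_norm M p' h" using Lp_norm_nonneg[of M p' h] by simp
    then show ?thesis
      using scaled[OF h, of "\<delta> / (2 * Lp_norm M p' h)"] \<delta>(1) by simp
  qed
  then show ?thesis using \<delta>(1) by (intro that[of "2 / \<delta>"]) auto
qed

text \<open>
  The algebraic laws hold pointwise, and the Hoelder inequality makes \<open>S\<close> Lipschitz with the norm of the
  density as constant.
\<close>

lemma AE_pointwise_imp_continuous_linear_op:
  fixes s :: "'o \<Rightarrow> 'y::{real_normed_vector, second_countable_topology} \<Rightarrow>\<^sub>L real"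
  assumes exps: "1 \<le> p" "p \<le> p'" "1 / p' + 1 / r = 1 / p"
    and s: "s \<in> Lp_dual M r" and S: "S \<in> Lp M p' \<rightarrow> Lp M p"
    and rep: "\<And>h. h \<in> Lp M p' \<Longrightarrow> AE \<omega> in M. S h \<omega> = blinfun_apply (s \<omega>) (h \<omega>)"
  shows "continuous_linear_op M p' p S"
  unfolding continuous_linear_op_def
proof (intro conjI ballI allI impI S)
  fix g h :: "'o \<Rightarrow> 'y" assume g: "g \<in> Lp M p'" and h: "h \<in> Lp M p'"
  show "AE \<omega> in M. S g \<omega> = S h \<omega>" if "AE \<omega> in M. g \<omega> = h \<omega>"
    using that rep[OF g] rep[OF h] by eventually_elim simp
  show "AE \<omega> in M. S (\<lambda>\<xi>. g \<xi> + h \<xi>) \<omega> = S g \<omega> + S h \<omega>"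
    using rep[OF g] rep[OF h] rep[OF Lp_add[OF g h]]
    by eventually_elim (simp add: blinfun.add_right)
next
  fix c and h :: "'o \<Rightarrow> 'y" assume h: "h \<in> Lp M p'"
  show "AE \<omega> in M. S (\<lambda>\<xi>. c *\<^sub>R h \<xi>) \<omega> = c * S h \<omega>"
    using rep[OF h] rep[OF Lp_scaleR[OF h]]
    by eventually_elim (simp add: blinfun.scaleR_right)
next
  fix g :: "'o \<Rightarrow> 'y" and \<epsilon> :: real assume g: "g \<in> Lp M p'" and \<epsilon>: "0 < \<epsilon>"
  define K where "K = Lp_norm M r (\<lambda>\<omega>. norm (s \<omega>))"
  have K: "0 \<le> K" by (simp add: K_def Lp_norm_nonneg)
  have bound: "Lp_norm M p (\<lambda>\<omega>. S h \<omega> - S g \<omega>) \<le> K * Lp_norm M p' (\<lambda>\<omega>. h \<omega> - g \<omega>)"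
    if h: "h \<in> Lp M p'" for h
    unfolding K_def
  proof (rule Lp_Holder[OF exps])
    show "(\<lambda>\<omega>. norm (s \<omega>)) \<in> Lp M r" using s by (simp add: Lp_dual_def)
    show "(\<lambda>\<omega>. h \<omega> - g \<omega>) \<in> Lp M p'"
      using Lp_add[OF h Lp_scaleR[OF g, of "-1"]] by simp
    show "(\<lambda>\<omega>. S h \<omega> - S g \<omega>) \<in> borel_measurable M"
      using S g h by (intro borel_measurable_diff) (auto intro: Lp_measurable)
    show "AE \<omega> in M. norm (S h \<omega> - S g \<omega>) \<le> norm (norm (s \<omega>)) * norm (h \<omega> - g \<omega>)"
      using rep[OF g] rep[OF h]
      by eventually_elim (simp, metis blinfun.diff_right norm_blinfun real_norm_def)
  qed
  show "\<exists>\<delta>>0. \<forall>h\<in>Lp M p'. Lp_norm M p' (\<lambda>\<omega>. h \<omega> - g \<omega>) < \<delta> \<longrightarrow>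
      Lp_norm M p (\<lambda>\<omega>. S h \<omega> - S g \<omega>) < \<epsilon>"
  proof (intro exI[of _ "\<epsilon> / (K + 1)"] conjI ballI impI)
    show "0 < \<epsilon> / (K + 1)" using \<epsilon> K by simp
    fix h assume h: "h \<in> Lp M p'" and small: "Lp_norm M p' (\<lambda>\<omega>. h \<omega> - g \<omega>) < \<epsilon> / (K + 1)"
    have "K * Lp_norm M p' (\<lambda>\<omega>. h \<omega> - g \<omega>) \<le> (K + 1) * Lp_norm M p' (\<lambda>\<omega>. h \<omega> - g \<omega>)"
      by (intro mult_right_mono) (auto simp: Lp_norm_nonneg)
    also have "\<dots> < \<epsilon>" using small K by (simp add: field_simps)
    finally show "Lp_norm M p (\<lambda>\<omega>. S h \<omega> - S g \<omega>) < \<epsilon>" using bound[OF h] by simp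
  qed
qed

text \<open>
  The values of the operator on the constants from a countable dense rational subspace determine the
  density outside a null set;
  letting the constant tend to \<open>h \<omega>\<close> for each \<open>\<omega>\<close> in \<open>S h - \<langle>s, u\<rangle> = S (h - u) \<le> f (h - u)\<close> compares
  \<open>S h\<close> with \<open>\<langle>s, h\<rangle>\<close> directly.
\<close>

lemma (in finite_measure) dominated_op_representation:
  fixes f :: "'y::{real_normed_vector, second_countable_topology} \<Rightarrow> 'a \<Rightarrow> real"
  assumes S: "continuous_linear_op M p' p S"
    and cont: "AE \<omega> in M. continuous_on UNIV (\<lambda>y. f y \<omega>)"
    and zero: "AE \<omega> in M. f 0 \<omega> = 0"
    and dom: "\<And>h. h \<in> Lp M p' \<Longrightarrow> AE \<omega> in M. S h \<omega> \<le> f (h \<omega>) \<omega>"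
  obtains s where "\<And>y. (\<lambda>\<omega>. blinfun_apply (s \<omega>) y) \<in> borel_measurable M"
    "AE \<omega> in M. \<forall>y. blinfun_apply (s \<omega>) y \<le> f y \<omega>"
    "\<And>h. h \<in> Lp M p' \<Longrightarrow> AE \<omega> in M. S h \<omega> = blinfun_apply (s \<omega>) (h \<omega>)"
proof -
  obtain D :: "'y set" where D: "countable D" "closure D = UNIV" "0 \<in> D"
      "\<And>u v. u \<in> D \<Longrightarrow> v \<in> D \<Longrightarrow> u + v \<in> D" "\<And>q u. u \<in> D \<Longrightarrow> of_rat q *\<^sub>R u \<in> D"
    by (rule countable_dense_rational_subspace) blast
  have const: "(\<lambda>_. y) \<in> Lp M p'" for y :: 'y by (rule Lp_bounded[of _ "norm y"]) auto
  define l where "l \<omega> y = S (\<lambda>_. y) \<omega>" for \<omega> and y :: 'y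
  have l_meas[measurable]: "(\<lambda>\<omega>. l \<omega> y) \<in> borel_measurable M" for y
    unfolding l_def by (rule Lp_measurable[OF continuous_linear_op_mem[OF S const]])
  have l_add: "AE \<omega> in M. \<forall>u\<in>D. \<forall>v\<in>D. l \<omega> (u + v) = l \<omega> u + l \<omega> v"
    unfolding l_def using continuous_linear_op_add[OF S const const]
    by (simp add: AE_ball_countable D(1))
  have l_scale: "AE \<omega> in M. \<forall>q. \<forall>u\<in>D. l \<omega> (of_rat q *\<^sub>R u) = of_rat q * l \<omega> u"
    unfolding l_def using continuous_linear_op_scale[OF S const]
    by (simp add: AE_ball_countable AE_all_countable D(1))
  have l_le: "AE \<omega> in M. \<forall>u\<in>D. l \<omega> u \<le> f u \<omega>"
    unfolding l_def using dom[OF const] by (simp add: AE_ball_countable D(1))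
  have "AE \<omega> in M. \<exists>T::'y \<Rightarrow>\<^sub>L real. (\<forall>u\<in>D. blinfun_apply T u = l \<omega> u) \<and> (\<forall>u. blinfun_apply T u \<le> f u \<omega>)"
    using l_add l_scale l_le cont zero
    by eventually_elim (rule dominated_rational_linear_extends[OF D(2,4,5)], auto)
  then obtain N where N: "N \<in> null_sets M" and ex: "\<And>\<omega>. \<omega> \<in> space M - N \<Longrightarrow>
      \<exists>T::'y \<Rightarrow>\<^sub>L real. (\<forall>u\<in>D. blinfun_apply T u = l \<omega> u) \<and> (\<forall>u. blinfun_apply T u \<le> f u \<omega>)"
    by (elim AE_E3) blast
  obtain T :: "'a \<Rightarrow> 'y \<Rightarrow>\<^sub>L real" where T: "\<And>\<omega>. \<omega> \<in> space M - N \<Longrightarrow>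
      (\<forall>u\<in>D. blinfun_apply (T \<omega>) u = l \<omega> u) \<and> (\<forall>u. blinfun_apply (T \<omega>) u \<le> f u \<omega>)"
    using ex by metis
  have [measurable]: "N \<in> sets M" using N by auto
  \<comment> \<open>Off the exceptional set the choice of \<open>T\<close> is forced by its values on \<open>D\<close>, which is why an arbitrary
    choice is measurable once it is set to 0 on the exceptional set.\<close>
  define s where "s \<omega> = (if \<omega> \<in> N then 0 else T \<omega>)" for \<omega>
  have notN: "AE \<omega> in M. \<omega> \<in> space M - N" using AE_not_in[OF N] AE_space by eventually_elim simp
  have sD: "(\<lambda>\<omega>. blinfun_apply (s \<omega>) u) \<in> borel_measurable M" if "u \<in> D" for u
  proof -
    have "(\<lambda>\<omega>. if \<omega> \<in> N then 0 else l \<omega> u) \<in> borel_measurable M" by measurable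
    then show ?thesis
      by (rule measurable_cong[THEN iffD1, rotated]) (use T that in \<open>auto simp: s_def\<close>)
  qed
  show ?thesis
  proof (rule that)
    fix y
    have "y \<in> closure D" using D(2) by simp
    then obtain d where d: "\<And>n. d n \<in> D" "d \<longlonglongrightarrow> y" unfolding closure_sequential by blast
    show "(\<lambda>\<omega>. blinfun_apply (s \<omega>) y) \<in> borel_measurable M"
      by (rule borel_measurable_LIMSEQ_real[of M "\<lambda>n \<omega>. blinfun_apply (s \<omega>) (d n)"])
         (auto intro!: tendsto_intros d sD)
  next
    show "AE \<omega> in M. \<forall>y. blinfun_apply (s \<omega>) y \<le> f y \<omega>"
      using notN by eventually_elim (use T in \<open>simp add: s_def\<close>)
  next
    have le: "AE \<omega> in M. S h \<omega> \<le> blinfun_apply (s \<omega>) (h \<omega>)" if h: "h \<in> Lp M p'" for h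
    proof -
      have "AE \<omega> in M. S h \<omega> + l \<omega> (- u) \<le> f (h \<omega> - u) \<omega>" for u
        using dom[OF Lp_add[OF h const[of "- u"]]] continuous_linear_op_add[OF S h const[of "- u"]]
        by eventually_elim (simp add: l_def)
      then have "AE \<omega> in M. \<forall>u\<in>D. S h \<omega> + l \<omega> (- u) \<le> f (h \<omega> - u) \<omega>"
        by (simp add: AE_ball_countable D(1))
      then show ?thesis using notN cont zero
      proof eventually_elim
        case (elim \<omega>)
        have cf: "continuous_on UNIV (\<lambda>u. f (h \<omega> - u) \<omega>)"
          by (rule continuous_on_compose2[OF elim(3)]) (auto intro!: continuous_intros)
        have "S h \<omega> - blinfun_apply (s \<omega>) (h \<omega>) \<le> f (h \<omega> - h \<omega>) \<omega>"
        proof (rule le_on_dense_imp_le[OF D(2) _ cf])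
          fix u assume u: "u \<in> D"
          then have "- u \<in> D" using D(5)[of u "-1"] by simp
          then have "l \<omega> (- u) = - blinfun_apply (s \<omega>) u"
            using T[OF elim(2)] elim(2) by (simp add: s_def blinfun.minus_right flip: blinfun.minus_right)
          then show "S h \<omega> - blinfun_apply (s \<omega>) u \<le> f (h \<omega> - u) \<omega>" using elim(1) u by force
        qed (auto intro!: continuous_intros)
        then show ?case using elim(4) by simp
      qed
    qed
    fix h :: "'a \<Rightarrow> 'y" assume h: "h \<in> Lp M p'"
    have "AE \<omega> in M. S (\<lambda>\<xi>. - h \<xi>) \<omega> = - S h \<omega>"
      using continuous_linear_op_scale[OF S h, of "-1"] by simp
    then show "AE \<omega> in M. S h \<omega> = blinfun_apply (s \<omega>) (h \<omega>)"
      using le[OF h] le[OF Lp_scaleR[OF h, of "-1"]]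
      by eventually_elim (simp add: blinfun.minus_right)
  qed
qed

text \<open>
  Testing the operator with \<open>\<phi> e\<close>, where \<open>e\<close> almost norms the density, reduces the integrability of the
  dual norm to the scalar converse of the Hoelder inequality. The factor 2 is the loss in the choice of
  \<open>e\<close>, as the norm of \<open>s \<omega>\<close> need not be attained.
\<close>

lemma (in finite_measure) representing_density_in_Lp_dual:
  fixes s :: "'a \<Rightarrow> 'y::{real_normed_vector, second_countable_topology} \<Rightarrow>\<^sub>L real"
  assumes exps: "1 \<le> p" "p \<le> p'" "1 / p' + 1 / r = 1 / p"
    and S: "continuous_linear_op M p' p S"
    and s: "\<And>y. (\<lambda>\<omega>. blinfun_apply (s \<omega>) y) \<in> borel_measurable M"
    and rep: "\<And>h. h \<in> Lp M p' \<Longrightarrow> AE \<omega> in M. S h \<omega> = blinfun_apply (s \<omega>) (h \<omega>)"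
  shows "s \<in> Lp_dual M r"
proof -
  have p: "0 < p" "0 < p'" using exps by (auto intro: less_le_trans[OF zero_less_one])
  note norm_weak_star_measurable[OF s, measurable]
  obtain e where e[measurable]: "e \<in> borel_measurable M" and e1: "\<And>\<omega>. norm (e \<omega>) \<le> 1"
    and es: "\<And>\<omega>. norm (s \<omega>) / 2 \<le> blinfun_apply (s \<omega>) (e \<omega>)"
    by (rule almost_norming_selection[OF s]) blast
  obtain K where K: "0 \<le> K" "\<And>h. h \<in> Lp M p' \<Longrightarrow> Lp_norm M p (S h) \<le> K * Lp_norm M p' h"
    by (rule continuous_linear_op_bounded[OF S p]) blast
  have "(\<lambda>\<omega>. norm (s \<omega>)) \<in> Lp M r"
  proof (rule converse_Holder[OF exps, where K = "2 * K"])
    fix \<phi> :: "'a \<Rightarrow> real" and C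
    assume \<phi>[measurable]: "\<phi> \<in> borel_measurable M" and C: "\<And>\<omega>. 0 \<le> \<phi> \<omega> \<and> \<phi> \<omega> \<le> C"
    let ?h = "\<lambda>\<omega>. \<phi> \<omega> *\<^sub>R e \<omega>"
    have \<phi>L: "\<phi> \<in> Lp M p'" using C by (intro Lp_bounded[of _ C]) auto
    have le\<phi>: "norm (?h \<omega>) \<le> 1 * norm (\<phi> \<omega>)" for \<omega>
      using mult_left_mono[OF e1[of \<omega>], of "\<bar>\<phi> \<omega>\<bar>"] by simp
    have h: "?h \<in> Lp M p'" by (rule Lp_dominated[OF _ \<phi>L, of _ 1]) (use le\<phi> in auto)
    have dom: "AE \<omega> in M. norm (\<phi> \<omega> * norm (s \<omega>)) \<le> 2 * norm (S ?h \<omega>)"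
      using rep[OF h]
    proof eventually_elim
      case (elim \<omega>)
      have "\<phi> \<omega> * (norm (s \<omega>) / 2) \<le> \<phi> \<omega> * blinfun_apply (s \<omega>) (e \<omega>)"
        using C es by (intro mult_left_mono) auto
      moreover have "0 \<le> \<phi> \<omega> * norm (s \<omega>)" using C by simp
      ultimately show ?case
        unfolding elim real_norm_def blinfun.scaleR_right real_scaleR_def by linarith
    qed
    have "Lp_norm M p (\<lambda>\<omega>. \<phi> \<omega> * norm (s \<omega>)) \<le> 2 * Lp_norm M p (S ?h)"
      using dom continuous_linear_op_mem[OF S h] by (intro Lp_norm_mono p) auto
    also have "\<dots> \<le> 2 * (K * Lp_norm M p' ?h)" using K(2)[OF h] by simp
    also have "\<dots> \<le> 2 * (K * (1 * Lp_norm M p' \<phi>))"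
      using K(1) \<phi>L le\<phi> by (intro mult_left_mono Lp_norm_mono p) auto
    finally show "(\<lambda>\<omega>. \<phi> \<omega> * norm (s \<omega>)) \<in> Lp M p \<and>
        Lp_norm M p (\<lambda>\<omega>. \<phi> \<omega> * norm (s \<omega>)) \<le> 2 * K * Lp_norm M p' \<phi>"
      using Lp_dominated[OF _ continuous_linear_op_mem[OF S h] dom] by simp
  qed auto
  then show ?thesis using s by (simp add: Lp_dual_def)
qed

section \<open>The subdifferential of a superposition operator\<close>

theorem theorem2p1:
  fixes M :: "'o measure"
    and p p' r :: ennreal
    and f :: "'y::{banach, second_countable_topology} \<Rightarrow> 'o \<Rightarrow> real"
    and F S :: "('o \<Rightarrow> 'y) \<Rightarrow> 'o \<Rightarrow> real"
    and x :: "'o \<Rightarrow> 'y"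
  assumes "prob_space M"
    and "1 \<le> p" and "p \<le> p'" and "p' \<le> \<infinity>"
    and "1 / p' + 1 / r = 1 / p"
    and "convex_integrand M f"
    and "F \<in> Lp M p' \<rightarrow> Lp M p"
    and "\<forall>u\<in>Lp M p'. AE \<omega> in M. F u \<omega> = f (u \<omega>) \<omega>"
    and "x \<in> Lp M p'"
    and "AE \<omega> in M. convex_on UNIV (\<lambda>y. f y \<omega>) \<and> isCont (\<lambda>y. f y \<omega>) (x \<omega>)"
    and "S \<in> Lp M p' \<rightarrow> Lp M p"
  shows "S \<in> op_subdiff M p' p F x \<longleftrightarrow>
    (\<exists>s\<in>Lp_dual M r.
       (AE \<omega> in M. s \<omega> \<in> subdiff (\<lambda>y. f y \<omega>) (x \<omega>))
       \<and> (\<forall>h\<in>Lp M p'. AE \<omega> in M. S h \<omega> = blinfun_apply (s \<omega>) (h \<omega>)))"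
proof -
  interpret prob_space M by fact
  note exps = \<open>1 \<le> p\<close> \<open>p \<le> p'\<close> \<open>1 / p' + 1 / r = 1 / p\<close>
  note x = \<open>x \<in> Lp M p'\<close>
  have increment: "AE \<omega> in M. F (\<lambda>\<xi>. x \<xi> + h \<xi>) \<omega> - F x \<omega> = f (x \<omega> + h \<omega>) \<omega> - f (x \<omega>) \<omega>"
    if "h \<in> Lp M p'" for h
  proof -
    have "AE \<omega> in M. F (\<lambda>\<xi>. x \<xi> + h \<xi>) \<omega> = f (x \<omega> + h \<omega>) \<omega>" "AE \<omega> in M. F x \<omega> = f (x \<omega>) \<omega>"
      using assms(8) x Lp_add[OF x that] by auto
    then show ?thesis by eventually_elim simp
  qed
  show ?thesis
  proof
    assume "S \<in> op_subdiff M p' p F x"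
    then have S: "continuous_linear_op M p' p S"
      and sub: "\<And>h. h \<in> Lp M p' \<Longrightarrow> AE \<omega> in M. S h \<omega> \<le> F (\<lambda>\<xi>. x \<xi> + h \<xi>) \<omega> - F x \<omega>"
      by (auto simp: op_subdiff_def)
    \<comment> \<open>The increment of \<open>f\<close> from \<open>x \<omega>\<close>: functionals below it are the elements of \<open>\<partial>f(x(\<omega>), \<omega>)\<close>.\<close>
    define g where "g y \<omega> = f (x \<omega> + y) \<omega> - f (x \<omega>) \<omega>" for y \<omega>
    have "AE \<omega> in M. continuous_on UNIV (\<lambda>y. f y \<omega>)"
      using assms(6) by (auto simp: convex_integrand_def)
    then have cont: "AE \<omega> in M. continuous_on UNIV (\<lambda>y. g y \<omega>)"
      unfolding g_def
      by eventually_elim (intro continuous_intros, rule continuous_on_compose2, auto intro!: continuous_intros)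
    have zero: "AE \<omega> in M. g 0 \<omega> = 0" by (simp add: g_def)
    have dom: "AE \<omega> in M. S h \<omega> \<le> g (h \<omega>) \<omega>" if "h \<in> Lp M p'" for h
      using sub[OF that] increment[OF that] by eventually_elim (simp add: g_def)
    obtain s where s: "\<And>y. (\<lambda>\<omega>. blinfun_apply (s \<omega>) y) \<in> borel_measurable M"
      and sg: "AE \<omega> in M. \<forall>y. blinfun_apply (s \<omega>) y \<le> g y \<omega>"
      and rep: "\<And>h. h \<in> Lp M p' \<Longrightarrow> AE \<omega> in M. S h \<omega> = blinfun_apply (s \<omega>) (h \<omega>)"
      using dominated_op_representation[OF S cont zero dom] by blast
    have "AE \<omega> in M. s \<omega> \<in> subdiff (\<lambda>y. f y \<omega>) (x \<omega>)"
      using sg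
    proof eventually_elim
      case (elim \<omega>)
      have "f (x \<omega>) \<omega> + blinfun_apply (s \<omega>) (z - x \<omega>) \<le> f z \<omega>" for z
        using elim[rule_format, of "z - x \<omega>"] by (simp add: g_def)
      then show ?case by (simp add: subdiff_def)
    qed
    moreover have "s \<in> Lp_dual M r"
      by (rule representing_density_in_Lp_dual[OF exps S s rep])
    ultimately show "\<exists>s\<in>Lp_dual M r. (AE \<omega> in M. s \<omega> \<in> subdiff (\<lambda>y. f y \<omega>) (x \<omega>))
       \<and> (\<forall>h\<in>Lp M p'. AE \<omega> in M. S h \<omega> = blinfun_apply (s \<omega>) (h \<omega>))"
      using rep by blast
  next
    assume "\<exists>s\<in>Lp_dual M r. (AE \<omega> in M. s \<omega> \<in> subdiff (\<lambda>y. f y \<omega>) (x \<omega>))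
       \<and> (\<forall>h\<in>Lp M p'. AE \<omega> in M. S h \<omega> = blinfun_apply (s \<omega>) (h \<omega>))"
    then obtain s where s: "s \<in> Lp_dual M r"
      and sub: "AE \<omega> in M. s \<omega> \<in> subdiff (\<lambda>y. f y \<omega>) (x \<omega>)"
      and rep: "\<And>h. h \<in> Lp M p' \<Longrightarrow> AE \<omega> in M. S h \<omega> = blinfun_apply (s \<omega>) (h \<omega>)"
      by blast
    have "AE \<omega> in M. S h \<omega> \<le> F (\<lambda>\<xi>. x \<xi> + h \<xi>) \<omega> - F x \<omega>" if h: "h \<in> Lp M p'" for h
      using sub rep[OF h] increment[OF h]
    proof eventually_elim
      case (elim \<omega>)
      have "f (x \<omega>) \<omega> + blinfun_apply (s \<omega>) (x \<omega> + h \<omega> - x \<omega>) \<le> f (x \<omega> + h \<omega>) \<omega>"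
        using elim(1) unfolding subdiff_def by blast
      then show ?case using elim by simp
    qed
    then show "S \<in> op_subdiff M p' p F x"
      using AE_pointwise_imp_continuous_linear_op[OF exps s assms(11) rep]
      by (simp add: op_subdiff_def)
  qed
qed

end
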